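(* Let $r\geq 2$, $n\geq 2r+1$ and $k\geq 2$. If $D$ is a $k$-tuple dominating set of $K(n,r)$, then $D$ (viewed as a set of $r$-subsets of $[n]\subseteq[n+1]$) is a $k$-tuple dominating set of $K(n+1,r)$. Consequently, $\gamma_{\times k}(K(n+1,r))\leq \gamma_{\times k}(K(n,r))$ for every such $n$ for which $\gamma_{\times k}(K(n,r))$ is defined.
   Context: The Kneser graph $K(n,r)$ has as vertices the $r$-subsets of $[n]=\{1,\dots,n\}$, two vertices adjacent iff disjoint. For a vertex $v$, $N[v]$ is its closed neighbourhood. A set $D$ of vertices is a $k$-tuple dominating set if $|N[v]\cap D|\geq k$ for every vertex $v$; $\gamma_{\times k}(K(n,r))$ is the minimum cardinality of such a set (defined when $k\leq \binom{n-r}{r}+1$). *)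

theory Defs
  imports "Graph_Theory.Digraph"
begin

text \<open>Undirected graphs are symmetric digraphs, following the locale \<^locale>\<open>graph\<close>:
  an edge \<open>{A, B}\<close> is represented by the two arcs \<open>(A, B)\<close> and \<open>(B, A)\<close>.\<close>

definition kneser_graph :: "nat \<Rightarrow> nat \<Rightarrow> (nat set, nat set \<times> nat set) pre_digraph" where
  "kneser_graph n r =
    (let V = {A. A \<subseteq> {1..n} \<and> card A = r} in
     \<lparr> verts = V,
       arcs = {(A, B). A \<in> V \<and> B \<in> V \<and> A \<inter> B = {}},
       tail = fst,
       head = snd \<rparr>)"

definition closed_neighbourhood :: "('a, 'b) pre_digraph \<Rightarrow> 'a \<Rightarrow> 'a set" where
  "closed_neighbourhood G v = insert v {w \<in> verts G. v \<rightarrow>\<^bsub>G\<^esub> w}"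

definition k_tuple_dominating :: "('a, 'b) pre_digraph \<Rightarrow> nat \<Rightarrow> 'a set \<Rightarrow> bool" where
  "k_tuple_dominating G k D \<longleftrightarrow>
     D \<subseteq> verts G \<and> (\<forall>v \<in> verts G. k \<le> card (closed_neighbourhood G v \<inter> D))"

text \<open>Only meaningful if \<open>G\<close> is finite and has a \<open>k\<close>-tuple dominating set; the lemma
  \<open>kneser_k_tuple_dominating_exists\<close> below shows when this holds for Kneser graphs.\<close>

definition k_tuple_domination_number :: "('a, 'b) pre_digraph \<Rightarrow> nat \<Rightarrow> nat" where
  "k_tuple_domination_number G k = Min {card D | D. k_tuple_dominating G k D}"

lemma kneser_graph_simps [simp]:
  "verts (kneser_graph n r) = {A. A \<subseteq> {1..n} \<and> card A = r}"
  "arcs (kneser_graph n r) =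
     {(A, B). A \<in> verts (kneser_graph n r) \<and> B \<in> verts (kneser_graph n r) \<and> A \<inter> B = {}}"
  "tail (kneser_graph n r) = fst"
  "head (kneser_graph n r) = snd"
  by (simp_all add: kneser_graph_def Let_def)

lemma finite_kneser_vertices: "finite (verts (kneser_graph n r))"
  by (rule finite_subset[of _ "Pow {1..n}"]) auto

lemma finite_kneser_arcs: "finite (arcs (kneser_graph n r))"
  by (rule finite_subset[of _ "verts (kneser_graph n r) \<times> verts (kneser_graph n r)"])
    (auto intro: finite_cartesian_product finite_kneser_vertices simp del: kneser_graph_simps(1)
      simp: kneser_graph_simps(2))

lemma kneser_dominates_iff:
  "A \<rightarrow>\<^bsub>kneser_graph n r\<^esub> B \<longleftrightarrow>
     A \<in> verts (kneser_graph n r) \<and> B \<in> verts (kneser_graph n r) \<and> A \<inter> B = {}"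
  by (simp add: arcs_ends_def arc_to_ends_def)

lemma kneser_graph_is_graph:
  assumes "r \<ge> 1"
  shows "graph (kneser_graph n r)"
proof -
  let ?G = "kneser_graph n r"
  have wf: "wf_digraph ?G"
    by (rule wf_digraph.intro) auto
  have fin: "fin_digraph ?G"
    using wf finite_kneser_vertices finite_kneser_arcs by (rule wf_digraph.fin_digraphI)
  have loopfree: "loopfree_digraph ?G"
    using wf assms
    by (auto intro!: loopfree_digraph.intro simp: loopfree_digraph_axioms_def)
  have nomulti: "nomulti_digraph ?G"
    using wf
    by (auto intro!: nomulti_digraph.intro simp: nomulti_digraph_axioms_def arc_to_ends_def)
  have "symmetric ?G"
    unfolding symmetric_def sym_def by (metis Int_commute kneser_dominates_iff)
  with digraph.intro[OF fin loopfree nomulti] show ?thesis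
    by (rule digraph.graphI)
qed

lemma card_kneser_closed_neighbourhood:
  assumes "r \<ge> 1" and v: "v \<in> verts (kneser_graph n r)"
  shows "card (closed_neighbourhood (kneser_graph n r) v) = ((n - r) choose r) + 1"
proof -
  have vs: "v \<subseteq> {1..n}" "card v = r"
    using v by auto
  have ne: "v \<noteq> {}" using vs assms(1) by auto
  have eq: "closed_neighbourhood (kneser_graph n r) v =
      insert v {B. B \<subseteq> {1..n} - v \<and> card B = r}"
    unfolding closed_neighbourhood_def kneser_dominates_iff using vs by auto
  have notin: "v \<notin> {B. B \<subseteq> {1..n} - v \<and> card B = r}"
    using ne by auto
  have "card {B. B \<subseteq> {1..n} - v \<and> card B = r} = (n - r) choose r"
    using n_subsets[of "{1..n} - v" r] vs by (simp add: card_Diff_subset finite_subset[OF vs(1)])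
  moreover have "finite {B. B \<subseteq> {1..n} - v \<and> card B = r}"
    by (rule finite_subset[of _ "Pow {1..n}"]) auto
  ultimately show ?thesis using notin by (simp add: eq)
qed

lemma finite_kneser_closed_neighbourhood:
  assumes "v \<in> verts (kneser_graph n r)"
  shows "finite (closed_neighbourhood (kneser_graph n r) v)"
  by (rule finite_subset[OF _ finite_kneser_vertices[of n r]])
    (use assms in \<open>auto simp: closed_neighbourhood_def\<close>)

lemma kneser_k_tuple_dominating_exists:
  assumes "r \<ge> 1" and "r \<le> n"
  shows "(\<exists>D. k_tuple_dominating (kneser_graph n r) k D) \<longleftrightarrow> k \<le> ((n - r) choose r) + 1"
proof
  let ?G = "kneser_graph n r"
  assume "\<exists>D. k_tuple_dominating ?G k D"
  then obtain D where D: "k_tuple_dominating ?G k D" by blast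
  have v: "{1..r} \<in> verts ?G" using assms by auto
  have "k \<le> card (closed_neighbourhood ?G {1..r} \<inter> D)"
    using D v unfolding k_tuple_dominating_def by blast
  also have "\<dots> \<le> card (closed_neighbourhood ?G {1..r})"
    by (rule card_mono[OF finite_kneser_closed_neighbourhood[OF v]]) blast
  finally show "k \<le> ((n - r) choose r) + 1"
    using card_kneser_closed_neighbourhood[OF assms(1) v] by simp
next
  let ?G = "kneser_graph n r"
  assume k: "k \<le> ((n - r) choose r) + 1"
  have "closed_neighbourhood ?G v \<inter> verts ?G = closed_neighbourhood ?G v"
    if "v \<in> verts ?G" for v
    using that unfolding closed_neighbourhood_def by blast
  then have "k_tuple_dominating ?G k (verts ?G)"
    using k card_kneser_closed_neighbourhood[OF assms(1), of _ n]
    by (simp add: k_tuple_dominating_def del: kneser_graph_simps)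
  then show "\<exists>D. k_tuple_dominating ?G k D" by blast
qed

end

theory Submission
  imports Defs
begin

text \<open>Let \<open>v = insert (n + 1) u\<close> be a new vertex. Its neighbours in \<open>D\<close> form the family \<open>F\<close> of
  members of \<open>D\<close> disjoint from \<open>u\<close>. For \<open>x \<in> [n] - u\<close>, domination of the old vertex
  \<open>insert x u\<close> says that at least \<open>k - 1\<close> members of \<open>F\<close> avoid \<open>x\<close>. As \<open>k \<ge> 2\<close>, there is some
  \<open>B \<in> F\<close>; choosing \<open>x \<in> B\<close> gives \<open>k - 1\<close> members of \<open>F\<close> other than \<open>B\<close>.\<close>

lemma kneser_closed_neighbourhood:
  assumes "v \<in> verts (kneser_graph n r)"
  shows "closed_neighbourhood (kneser_graph n r) v =
    insert v {w \<in> verts (kneser_graph n r). v \<inter> w = {}}"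
  using assms unfolding closed_neighbourhood_def kneser_dominates_iff by blast

lemma k_tuple_dominating_finite:
  assumes "k_tuple_dominating (kneser_graph n r) k D"
  shows "finite D"
  using assms finite_kneser_vertices finite_subset unfolding k_tuple_dominating_def by blast

lemma k_tuple_dominating_kneser_Suc:
  assumes r: "1 \<le> r" "r \<le> n" and k: "2 \<le> k"
    and D: "k_tuple_dominating (kneser_graph n r) k D"
  shows "k_tuple_dominating (kneser_graph (Suc n) r) k D"
proof -
  let ?G = "kneser_graph n r" and ?H = "kneser_graph (Suc n) r"
  have fD: "finite D" using D by (rule k_tuple_dominating_finite)
  have DG: "D \<subseteq> verts ?G"
    and dom: "\<And>v. v \<in> verts ?G \<Longrightarrow> k \<le> card (closed_neighbourhood ?G v \<inter> D)"
    using D unfolding k_tuple_dominating_def by blast+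
  have GH: "verts ?G \<subseteq> verts ?H" by force
  have "k \<le> card (closed_neighbourhood ?H v \<inter> D)" if v: "v \<in> verts ?H" for v
  proof (cases "v \<in> verts ?G")
    case True
    \<comment> \<open>An old vertex loses no neighbour when the ground set grows, so its count in
      \<open>D\<close> cannot drop.\<close>
    have "closed_neighbourhood ?G v \<inter> D \<subseteq> closed_neighbourhood ?H v \<inter> D"
      unfolding kneser_closed_neighbourhood[OF True] kneser_closed_neighbourhood[OF v]
      using GH by blast
    then have "card (closed_neighbourhood ?G v \<inter> D) \<le> card (closed_neighbourhood ?H v \<inter> D)"
      using fD by (intro card_mono) auto
    then show ?thesis using dom[OF True] by linarith
  next
    case False
    have vs: "v \<subseteq> {1..Suc n}" "card v = r" "finite v"
      using v by (auto intro: finite_subset)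
    then have new: "Suc n \<in> v"
      using False by (auto simp: atLeastAtMostSuc_conv)
    define u where "u = v - {Suc n}"
    have u: "u \<subseteq> {1..n}" "finite u"
      using vs by (auto simp: u_def atLeastAtMostSuc_conv)
    have card_u: "Suc (card u) = r"
      unfolding u_def using card_Suc_Diff1[OF vs(3) new] vs(2) by simp
    define F where "F = {B \<in> D. u \<inter> B = {}}"
    have fF: "finite F" using fD by (simp add: F_def)
    have avoid: "k - 1 \<le> card {B \<in> F. x \<notin> B}" if x: "x \<in> {1..n} - u" for x
    proof -
      have xu: "insert x u \<in> verts ?G" using x u card_u by auto
      \<comment> \<open>The vertex \<open>insert x u\<close> may itself lie in \<open>D\<close> but
        contains \<open>x\<close>, so it is not counted on the right; this accounts for the loss of
        one in \<open>k - 1\<close>.\<close>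
      have "closed_neighbourhood ?G (insert x u) \<inter> D \<subseteq> insert (insert x u) {B \<in> F. x \<notin> B}"
        unfolding kneser_closed_neighbourhood[OF xu] F_def by blast
      then have "card (closed_neighbourhood ?G (insert x u) \<inter> D)
          \<le> card (insert (insert x u) {B \<in> F. x \<notin> B})"
        using fF by (intro card_mono) auto
      also have "\<dots> \<le> Suc (card {B \<in> F. x \<notin> B})"
        by (rule card_insert_le_m1) auto
      finally show ?thesis using dom[OF xu] by linarith
    qed
    \<comment> \<open>Some point outside \<open>u\<close> is needed to apply \<open>avoid\<close>;
      as \<open>k - 1\<close> is positive, this makes \<open>F\<close> nonempty.\<close>
    have "card u < card {1..n}" using card_u r by simp
    then obtain x where "x \<in> {1..n} - u"
      using u(2) by (metis all_not_in_conv card_mono Diff_eq_empty_iff leD)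
    then have "{B \<in> F. x \<notin> B} \<noteq> {}" using avoid[of x] k by fastforce
    then obtain B where B: "B \<in> F" by blast
    then have Bs: "B \<subseteq> {1..n}" "card B = r" "u \<inter> B = {}"
      using DG by (auto simp: F_def)
    then obtain y where y: "y \<in> B" using r by fastforce
    \<comment> \<open>Sets avoiding \<open>y\<close> differ from \<open>B\<close>. Since
      \<open>B\<close> is disjoint from \<open>u\<close>, the point \<open>y\<close> lies outside
      \<open>u\<close> and \<open>avoid\<close> applies to it.\<close>
    have "card {A \<in> F. y \<notin> A} \<le> card (F - {B})"
      using fF y by (intro card_mono) auto
    then have "k - 1 \<le> card (F - {B})"
      using avoid[of y] y Bs by fastforce
    then have "k \<le> card F"
      using card_Suc_Diff1[OF fF B] by linarith
    moreover have "F \<subseteq> closed_neighbourhood ?H v \<inter> D"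
    proof
      fix A assume A: "A \<in> F"
      then have "A \<in> verts ?G" using DG by (auto simp: F_def)
      \<comment> \<open>Old vertices never contain \<open>Suc n\<close>, so being disjoint from
        \<open>u\<close> suffices for being disjoint from \<open>v\<close>.\<close>
      moreover from this have "v \<inter> A = {}"
        using A by (auto simp: F_def u_def)
      ultimately show "A \<in> closed_neighbourhood ?H v \<inter> D"
        unfolding kneser_closed_neighbourhood[OF v] using A GH F_def by blast
    qed
    then have "card F \<le> card (closed_neighbourhood ?H v \<inter> D)"
      using fD by (intro card_mono) auto
    ultimately show ?thesis by linarith
  qed
  then show ?thesis
    using DG GH unfolding k_tuple_dominating_def by blast
qed

text \<open>\<open>Min\<close> is meaningful only on finite nonempty sets; this gives the finiteness
  needed to compare domination numbers.\<close>

lemma finite_k_tuple_dominating_cards: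
  "finite {card D | D. k_tuple_dominating (kneser_graph n r) k D}"
proof (rule finite_subset)
  show "{card D | D. k_tuple_dominating (kneser_graph n r) k D}
      \<subseteq> card ` Pow (verts (kneser_graph n r))"
    unfolding k_tuple_dominating_def by blast
qed (simp add: finite_kneser_vertices del: kneser_graph_simps)

theorem theorem12:
  fixes n r k :: nat
  assumes "r \<ge> 2" and "n \<ge> 2 * r + 1" and "k \<ge> 2"
  shows "(\<forall>D. k_tuple_dominating (kneser_graph n r) k D \<longrightarrow>
              k_tuple_dominating (kneser_graph (n + 1) r) k D) \<and>
         (k \<le> ((n - r) choose r) + 1 \<longrightarrow>
            k_tuple_domination_number (kneser_graph (n + 1) r) k
              \<le> k_tuple_domination_number (kneser_graph n r) k)"
proof (intro conjI impI)
  have r: "1 \<le> r" "r \<le> n" using assms by auto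
  show lift: "\<forall>D. k_tuple_dominating (kneser_graph n r) k D \<longrightarrow>
      k_tuple_dominating (kneser_graph (n + 1) r) k D"
    using k_tuple_dominating_kneser_Suc[OF r assms(3)] by simp
  assume "k \<le> ((n - r) choose r) + 1"
  then have "\<exists>D. k_tuple_dominating (kneser_graph n r) k D"
    using kneser_k_tuple_dominating_exists[OF r] by blast
  then show "k_tuple_domination_number (kneser_graph (n + 1) r) k
      \<le> k_tuple_domination_number (kneser_graph n r) k"
    \<comment> \<open>By \<open>lift\<close>, every cardinality attained for \<open>n\<close> is
      attained for \<open>n + 1\<close>, and the minimum over a larger set is no larger.\<close>
    unfolding k_tuple_domination_number_def
    using lift by (intro Min_antimono finite_k_tuple_dominating_cards) blast+
qed

end
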